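(* Let $\mathcal{H}$ be a nonzero complex Hilbert space and let $A,B\in\mathbb{B}(\mathcal{H})$. Then $$\omega(A+B)\le \frac{1}{\sqrt{2}}\,\omega\big((|A|+|B|)+i(|A^*|+|B^*|)\big).$$ Further, this inequality is sharp, in the sense that the factor $\frac{1}{\sqrt{2}}$ cannot be replaced by a smaller number: there is no real constant $c<\frac{1}{\sqrt{2}}$ such that $\omega(A+B)\le c\,\omega\big((|A|+|B|)+i(|A^*|+|B^*|)\big)$ holds for all $A,B\in\mathbb{B}(\mathcal{H})$.
   Context: $\mathbb{B}(\mathcal{H})$ is the $C^*$-algebra of bounded linear operators on $\mathcal{H}$; $A^*$ is the adjoint of $A$ and $|A|=(A^*A)^{1/2}$. The numerical radius is $\omega(A)=\sup_{\|x\|=1}|\langle Ax,x\rangle|$. *)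

theory Defs
  imports "HOL-Analysis.Analysis"
begin

class complex_vector = real_vector +
  fixes scaleC :: "complex \<Rightarrow> 'a \<Rightarrow> 'a"  (infixr "*\<^sub>C" 75)
  assumes scaleC_add_right: "a *\<^sub>C (x + y) = a *\<^sub>C x + a *\<^sub>C y"
    and scaleC_add_left: "(a + b) *\<^sub>C x = a *\<^sub>C x + b *\<^sub>C x"
    and scaleC_scaleC: "a *\<^sub>C (b *\<^sub>C x) = (a * b) *\<^sub>C x"
    and scaleC_one: "1 *\<^sub>C x = x"
    and scaleR_scaleC: "r *\<^sub>R x = complex_of_real r *\<^sub>C x"

text \<open>The inner product is linear in its first argument.\<close>

class complex_inner = complex_vector + real_normed_vector +
  fixes cinner :: "'a \<Rightarrow> 'a \<Rightarrow> complex"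
  assumes cinner_commute: "cinner x y = cnj (cinner y x)"
    and cinner_add_left: "cinner (x + y) z = cinner x z + cinner y z"
    and cinner_scaleC_left: "cinner (c *\<^sub>C x) y = c * cinner x y"
    and cinner_nonneg: "0 \<le> Re (cinner x x)"
    and cinner_eq_zero_iff: "cinner x x = 0 \<longleftrightarrow> x = 0"
    and norm_eq_sqrt_cinner: "norm x = sqrt (Re (cinner x x))"

class chilbert_space = complex_inner + complete_space

instantiation complex :: chilbert_space
begin

definition scaleC_complex :: "complex \<Rightarrow> complex \<Rightarrow> complex"
  where "scaleC_complex c x = c * x"

definition cinner_complex :: "complex \<Rightarrow> complex \<Rightarrow> complex"
  where "cinner_complex x y = x * cnj y"

instance
  by standard
    (auto simp: scaleC_complex_def cinner_complex_def algebra_simps scaleR_conv_of_real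
      cmod_def power2_eq_square)

end

definition bounded_clinear :: "('a::complex_inner \<Rightarrow> 'a) \<Rightarrow> bool"
  where "bounded_clinear A \<longleftrightarrow> bounded_linear A \<and> (\<forall>c x. A (c *\<^sub>C x) = c *\<^sub>C A x)"

text \<open>On a Hilbert space every bounded operator has exactly one adjoint and every positive
  operator exactly one positive square root, so the descriptions below are proper for the
  arguments to which they are applied.\<close>

definition cadjoint :: "('a::chilbert_space \<Rightarrow> 'a) \<Rightarrow> ('a \<Rightarrow> 'a)"
  where "cadjoint A =
    (THE B. bounded_clinear B \<and> (\<forall>x y. cinner (A x) y = cinner x (B y)))"

definition positive_op :: "('a::chilbert_space \<Rightarrow> 'a) \<Rightarrow> bool"
  where "positive_op P \<longleftrightarrow> bounded_clinear P \<and> (\<forall>x. cinner (P x) x \<in> \<real>\<^sub>\<ge>\<^sub>0)"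

definition sqrt_op :: "('a::chilbert_space \<Rightarrow> 'a) \<Rightarrow> ('a \<Rightarrow> 'a)"
  where "sqrt_op T = (THE P. positive_op P \<and> P \<circ> P = T)"

definition abs_op :: "('a::chilbert_space \<Rightarrow> 'a) \<Rightarrow> ('a \<Rightarrow> 'a)"
  where "abs_op A = sqrt_op (cadjoint A \<circ> A)"

text \<open>For a bounded operator on a nonzero space the set below is nonempty and bounded above,
  so the real supremum is the true one.\<close>

definition numerical_radius :: "('a::complex_inner \<Rightarrow> 'a) \<Rightarrow> real"
  where "numerical_radius A = (SUP x\<in>{x. norm x = 1}. cmod (cinner (A x) x))"

end

theory Submission
  imports Defs
begin

text \<open>Writing \<open>p = \<langle>(|A| + |B|)x, x\<rangle>\<close> and \<open>q = \<langle>(|A*| + |B*|)x, x\<rangle>\<close>, the mixed Schwarz inequality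
  \<open>|\<langle>Ax, y\<rangle>|\<^sup>2 \<le> \<langle>|A|x, x\<rangle> \<langle>|A*|y, y\<rangle>\<close> and the inequality of the means give
  \<open>|\<langle>(A + B)x, x\<rangle>| \<le> (p + q) / 2 \<le> |p + iq| / sqrt 2\<close> for unit vectors \<open>x\<close>, and \<open>A = B = 1\<close> gives
  equality. The mixed Schwarz inequality needs no polar decomposition: by the intertwining relation
  \<open>A |A| = |A*| A\<close> it is the Cauchy-Schwarz inequality of the form \<open>|A*|\<close> when \<open>x\<close> lies in the range
  of \<open>|A|\<close>, it passes to the closure of this range, and \<open>A\<close> and \<open>|A|\<close> both vanish on the orthogonal
  complement.\<close>

section \<open>Complex inner products\<close>

lemma scaleC_zero_right [simp]: "c *\<^sub>C 0 = (0::'a::complex_vector)"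
  using scaleC_add_right[of c 0 "0::'a"] by simp

lemma scaleC_minus_right: "c *\<^sub>C (- x) = - (c *\<^sub>C x :: 'a::complex_vector)"
  using scaleC_add_right[of c x "- x"] by (simp add: eq_neg_iff_add_eq_0 add.commute)

lemma scaleC_diff_right: "c *\<^sub>C (x - y) = c *\<^sub>C x - (c *\<^sub>C y :: 'a::complex_vector)"
  using scaleC_add_right[of c x "- y"] by (simp add: scaleC_minus_right)

lemma scaleC_scaleR_commute: "c *\<^sub>C r *\<^sub>R x = r *\<^sub>R c *\<^sub>C (x::'a::complex_vector)"
  by (simp add: scaleR_scaleC scaleC_scaleC mult.commute)

lemma cinner_add_right: "cinner x (y + z) = cinner x y + cinner x (z::'a::complex_inner)"
  by (metis cinner_add_left cinner_commute complex_cnj_add)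

lemma cinner_scaleC_right: "cinner x (c *\<^sub>C y) = cnj c * cinner x (y::'a::complex_inner)"
  by (metis cinner_scaleC_left cinner_commute complex_cnj_mult)

lemma cinner_scaleR_left: "cinner (r *\<^sub>R x) y = of_real r * cinner x (y::'a::complex_inner)"
  by (simp add: scaleR_scaleC cinner_scaleC_left)

lemma cinner_scaleR_right: "cinner x (r *\<^sub>R y) = of_real r * cinner x (y::'a::complex_inner)"
  by (simp add: scaleR_scaleC cinner_scaleC_right)

lemma cinner_zero_left [simp]: "cinner 0 y = (0::complex)"
  using cinner_add_left[of 0 0 y] by simp

lemma cinner_zero_right [simp]: "cinner y 0 = (0::complex)"
  using cinner_add_right[of y 0 0] by simp

lemma cinner_minus_left: "cinner (- x) y = - cinner x (y::'a::complex_inner)"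
  using cinner_add_left[of x "- x" y] by (simp add: eq_neg_iff_add_eq_0 add.commute)

lemma cinner_minus_right: "cinner x (- y) = - cinner x (y::'a::complex_inner)"
  using cinner_add_right[of x y "- y"] by (simp add: eq_neg_iff_add_eq_0 add.commute)

lemma cinner_diff_left: "cinner (x - y) z = cinner x z - cinner y (z::'a::complex_inner)"
  using cinner_add_left[of x "- y" z] by (simp add: cinner_minus_left)

lemma cinner_diff_right: "cinner x (y - z) = cinner x y - cinner x (z::'a::complex_inner)"
  using cinner_add_right[of x y "- z"] by (simp add: cinner_minus_right)

lemmas cinner_simps = cinner_add_left cinner_add_right cinner_diff_left cinner_diff_right
  cinner_scaleC_left cinner_scaleC_right cinner_scaleR_left cinner_scaleR_right
  cinner_minus_left cinner_minus_right

lemma cinner_self: "cinner x x = of_real ((norm (x::'a::complex_inner))\<^sup>2)"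
proof (rule complex_eqI)
  show "Re (cinner x x) = Re (of_real ((norm x)\<^sup>2))"
    by (simp add: norm_eq_sqrt_cinner cinner_nonneg)
  show "Im (cinner x x) = Im (of_real ((norm x)\<^sup>2))"
    by (metis cinner_commute Reals_cnj_iff complex_is_Real_iff Im_complex_of_real)
qed

lemma Re_cinner_self: "Re (cinner x x) = (norm (x::'a::complex_inner))\<^sup>2"
  by (simp add: cinner_self)

lemma cinner_ext: "(\<And>z. cinner z x = cinner z y) \<Longrightarrow> x = (y::'a::complex_inner)"
  by (metis cinner_diff_right cinner_eq_zero_iff eq_iff_diff_eq_0)

text \<open>The normed space axioms give homogeneity for real scalars only; for complex ones it
  comes from the inner product.\<close>

lemma norm_scaleC: "norm (c *\<^sub>C x) = cmod c * norm (x::'a::complex_inner)"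
proof -
  have "complex_of_real ((norm (c *\<^sub>C x))\<^sup>2) = of_real ((cmod c)\<^sup>2) * of_real ((norm x)\<^sup>2)"
    unfolding cinner_self[of x, symmetric] cinner_self[of "c *\<^sub>C x", symmetric]
    by (simp only: complex_norm_square cinner_scaleC_left cinner_scaleC_right mult.assoc mult.left_commute)
  then have "(norm (c *\<^sub>C x))\<^sup>2 = (cmod c * norm x)\<^sup>2"
    unfolding of_real_mult[symmetric] of_real_eq_iff by (simp add: power_mult_distrib)
  then show ?thesis by simp
qed

section \<open>Bounded and positive operators\<close>

lemma bounded_clinear_bounded_linear: "bounded_clinear A \<Longrightarrow> bounded_linear A"
  by (simp add: bounded_clinear_def)

lemma bounded_clinear_scaleC: "bounded_clinear A \<Longrightarrow> A (c *\<^sub>C x) = c *\<^sub>C A x"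
  by (simp add: bounded_clinear_def)

lemmas bounded_clinear_simps =
  linear_add[OF bounded_linear.linear[OF bounded_clinear_bounded_linear]]
  linear_diff[OF bounded_linear.linear[OF bounded_clinear_bounded_linear]]
  linear_0[OF bounded_linear.linear[OF bounded_clinear_bounded_linear]]
  linear_scale[OF bounded_linear.linear[OF bounded_clinear_bounded_linear]]
  bounded_clinear_scaleC

lemma bounded_clinear_ident: "bounded_clinear (\<lambda>x. x)"
  by (simp add: bounded_clinear_def)

lemma bounded_clinear_zero: "bounded_clinear (\<lambda>x. 0)"
  by (simp add: bounded_clinear_def)

lemma bounded_clinear_comp:
  "bounded_clinear A \<Longrightarrow> bounded_clinear B \<Longrightarrow> bounded_clinear (\<lambda>x. A (B x))"
  by (auto simp: bounded_clinear_def intro: bounded_linear_compose)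

lemma bounded_clinear_add:
  "bounded_clinear A \<Longrightarrow> bounded_clinear B \<Longrightarrow> bounded_clinear (\<lambda>x. A x + B x)"
  by (auto simp: bounded_clinear_def scaleC_add_right intro: bounded_linear_add)

lemma bounded_clinear_diff:
  "bounded_clinear A \<Longrightarrow> bounded_clinear B \<Longrightarrow> bounded_clinear (\<lambda>x. A x - B x)"
  by (auto simp: bounded_clinear_def scaleC_diff_right intro: bounded_linear_sub)

lemma bounded_clinear_scaleR:
  "bounded_clinear A \<Longrightarrow> bounded_clinear (\<lambda>x. r *\<^sub>R A x)"
  by (auto simp: bounded_clinear_def scaleC_scaleR_commute intro: bounded_linear_const_scaleR)

lemma bounded_linear_scaleC: "bounded_linear (\<lambda>x::'a::complex_inner. c *\<^sub>C x)"
  by (rule bounded_linear_intro[where K = "cmod c"])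
    (auto simp: scaleC_add_right scaleC_scaleR_commute norm_scaleC)

lemma bounded_clinear_scaleC_comp:
  "bounded_clinear A \<Longrightarrow> bounded_clinear (\<lambda>x. c *\<^sub>C A x)"
  unfolding bounded_clinear_def
  by (auto simp: scaleC_scaleC mult.commute intro: bounded_linear_compose[OF bounded_linear_scaleC])

lemma positive_op_bounded_clinear: "positive_op P \<Longrightarrow> bounded_clinear P"
  by (simp add: positive_op_def)

lemma positive_op_Re: "positive_op P \<Longrightarrow> 0 \<le> Re (cinner (P x) x)"
  by (simp add: positive_op_def complex_nonneg_Reals_iff)

lemma positive_op_of_real: "positive_op P \<Longrightarrow> cinner (P x) x = of_real (Re (cinner (P x) x))"
  by (simp add: positive_op_def complex_nonneg_Reals_iff complex_eq_iff)

text \<open>Polarization: that the form of \<open>P\<close> is real at \<open>x + y\<close> and at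
  \<open>x + \<i> *\<^sub>C y\<close> relates first the imaginary and then the real parts of
  \<open>cinner (P x) y\<close> and \<open>cinner (P y) x\<close>.\<close>

lemma positive_op_hermitian:
  assumes "positive_op P"
  shows "cinner (P x) y = cinner x (P y)"
proof -
  note P = positive_op_bounded_clinear[OF assms]
  have Im0: "Im (cinner (P u) u) = 0" for u
    using assms by (simp add: positive_op_def complex_nonneg_Reals_iff)
  have "Im (cinner (P x) y) + Im (cinner (P y) x) = 0"
    using Im0[of "x + y"] Im0[of x] Im0[of y] by (simp add: bounded_clinear_simps[OF P] cinner_simps)
  moreover have "Re (cinner (P y) x) = Re (cinner (P x) y)"
    using Im0[of "x + \<i> *\<^sub>C y"] Im0[of x] Im0[of y]
    by (simp add: bounded_clinear_simps[OF P] cinner_simps)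
  ultimately have "cinner (P x) y = cnj (cinner (P y) x)"
    by (simp add: complex_eq_iff)
  then show ?thesis by (metis cinner_commute)
qed

lemma positive_opI:
  assumes "bounded_clinear P" "\<And>x y. cinner (P x) y = cinner x (P y)"
    "\<And>x. 0 \<le> Re (cinner (P x) x)"
  shows "positive_op P"
proof -
  have "Im (cinner (P x) x) = 0" for x
    by (metis assms(2) cinner_commute Reals_cnj_iff complex_is_Real_iff)
  then show ?thesis using assms by (simp add: positive_op_def complex_nonneg_Reals_iff)
qed

lemma positive_op_ident: "positive_op (\<lambda>x. x)"
  by (rule positive_opI) (auto simp: bounded_clinear_ident cinner_nonneg)

text \<open>The form of \<open>P\<close> is nonnegative at \<open>x - s *\<^sub>C y\<close>. Taking
  \<open>s\<close> as a real multiple of \<open>b\<close> turns its expansion into a real quadratic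
  in \<open>t\<close>. The form may be degenerate, so \<open>c = 0\<close> is a separate
  case.\<close>

lemma positive_op_Cauchy_Schwarz:
  assumes "positive_op P"
  shows "(cmod (cinner (P x) y))\<^sup>2 \<le> Re (cinner (P x) x) * Re (cinner (P y) y)"
proof -
  note P = positive_op_bounded_clinear[OF assms]
  define a b c where "a = Re (cinner (P x) x)" and "b = cinner (P x) y"
    and "c = Re (cinner (P y) y)"
  have yx: "cinner (P y) x = cnj b"
    by (metis positive_op_hermitian[OF assms] cinner_commute b_def)
  have quad: "0 \<le> a - 2 * t * (cmod b)\<^sup>2 + t\<^sup>2 * (cmod b)\<^sup>2 * c" for t :: real
  proof -
    define s where "s = of_real t * b"
    have "cinner (P (x - s *\<^sub>C y)) (x - s *\<^sub>C y) =
        cinner (P x) x - cnj s * b - s * cnj b + s * cnj s * cinner (P y) y"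
      by (simp add: bounded_clinear_simps[OF P] cinner_simps yx b_def algebra_simps)
    also have "\<dots> = of_real a - 2 * of_real t * (b * cnj b) + (of_real t)\<^sup>2 * (b * cnj b) * of_real c"
      unfolding a_def c_def positive_op_of_real[OF assms, symmetric]
      by (simp add: s_def power2_eq_square algebra_simps)
    also have "\<dots> = of_real (a - 2 * t * (cmod b)\<^sup>2 + t\<^sup>2 * (cmod b)\<^sup>2 * c)"
      unfolding complex_norm_square[symmetric] by simp
    finally show ?thesis
      using positive_op_Re[OF assms, of "x - s *\<^sub>C y"] by simp
  qed
  have "0 \<le> c" unfolding c_def by (rule positive_op_Re[OF assms])
  show ?thesis
  proof (cases "c = 0")
    case True
    have "b = 0"
    proof (rule ccontr)
      assume "b \<noteq> 0"
      \<comment> \<open>For \<open>c = 0\<close> the quadratic is affine in \<open>t\<close>, and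
        this \<open>t\<close> gives it the value -1.\<close>
      then show False using quad[of "(a + 1) / (2 * (cmod b)\<^sup>2)"] True by simp
    qed
    then show ?thesis using True by (simp add: b_def c_def)
  next
    case False
    then have "0 < c" using \<open>0 \<le> c\<close> by simp
    \<comment> \<open>The choice \<open>t = 1/c\<close> minimizes the quadratic.\<close>
    have "0 \<le> c * (a - 2 * (1/c) * (cmod b)\<^sup>2 + (1/c)\<^sup>2 * (cmod b)\<^sup>2 * c)"
      using quad[of "1/c"] \<open>0 < c\<close> by simp
    also have "\<dots> = a * c - (cmod b)\<^sup>2"
      using \<open>0 < c\<close> by (simp add: field_simps power2_eq_square)
    finally show ?thesis by (simp add: a_def b_def c_def)
  qed
qed

lemma cmod_cinner_le: "cmod (cinner x y) \<le> norm x * norm (y::'a::chilbert_space)"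
proof -
  have "(cmod (cinner x y))\<^sup>2 \<le> (norm x * norm y)\<^sup>2"
    using positive_op_Cauchy_Schwarz[OF positive_op_ident, of x y]
    by (simp add: Re_cinner_self power_mult_distrib)
  then show ?thesis by (rule power2_le_imp_le) simp
qed

text \<open>Cauchy-Schwarz in the form that yields joint continuity, so that limits pass through the
  inner product.\<close>

lemma bounded_bilinear_cinner: "bounded_bilinear (cinner :: 'a::chilbert_space \<Rightarrow> 'a \<Rightarrow> complex)"
proof
  show "\<exists>K. \<forall>a b :: 'a. norm (cinner a b) \<le> norm a * norm b * K"
    by (rule exI[of _ 1]) (simp add: cmod_cinner_le)
qed (auto simp: cinner_simps scaleR_conv_of_real)

lemma positive_op_eq_0:
  assumes "positive_op P" "Re (cinner (P x) x) = 0"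
  shows "P x = 0"
proof -
  have "cmod (cinner (P x) (P x)) = 0"
    using positive_op_Cauchy_Schwarz[OF assms(1), of x "P x"] assms(2) by simp
  then show ?thesis by (simp add: cinner_eq_zero_iff)
qed

text \<open>This is the operator inequality P^2 <= c P, obtained without functional calculus: apply
  Cauchy-Schwarz to \<open>x\<close> and \<open>P x\<close>, bound the second factor by
  \<open>c * (norm (P x))\<^sup>2\<close>, and cancel.\<close>

lemma positive_op_norm_square_le:
  assumes "positive_op P" "\<And>x. norm (P x) \<le> c * norm x"
  shows "(norm (P x))\<^sup>2 \<le> c * Re (cinner (P x) x)"
proof (cases "P x = 0")
  case False
  have "((norm (P x))\<^sup>2)\<^sup>2 \<le> Re (cinner (P x) x) * Re (cinner (P (P x)) (P x))"
    using positive_op_Cauchy_Schwarz[OF assms(1), of x "P x"] by (simp add: cinner_self norm_power)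
  also have "\<dots> \<le> Re (cinner (P x) x) * (c * (norm (P x))\<^sup>2)"
  proof (rule mult_left_mono)
    have "Re (cinner (P (P x)) (P x)) \<le> norm (P (P x)) * norm (P x)"
      using complex_Re_le_cmod cmod_cinner_le order_trans by blast
    also have "\<dots> \<le> c * norm (P x) * norm (P x)"
      by (rule mult_right_mono[OF assms(2)]) simp
    finally show "Re (cinner (P (P x)) (P x)) \<le> c * (norm (P x))\<^sup>2"
      by (simp add: power2_eq_square mult.assoc)
  qed (rule positive_op_Re[OF assms(1)])
  finally have "(norm (P x))\<^sup>2 * (norm (P x))\<^sup>2 \<le> (c * Re (cinner (P x) x)) * (norm (P x))\<^sup>2"
    by (simp add: power2_eq_square mult_ac)
  then show ?thesis using False by (subst (asm) mult_le_cancel_right) simp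
qed simp

section \<open>Orthogonal projection and adjoints\<close>

text \<open>Pythagoras: the subtracted vector is the component of \<open>v\<close> along
  \<open>w\<close>.\<close>

lemma norm_diff_scaleC_square:
  assumes "w \<noteq> 0"
  shows "(norm (v - (cinner v w / of_real ((norm w)\<^sup>2)) *\<^sub>C w))\<^sup>2
    = (norm v)\<^sup>2 - (cmod (cinner v w))\<^sup>2 / (norm (w::'a::complex_inner))\<^sup>2"
proof -
  define b n where "b = cinner v w" and "n = (norm w)\<^sup>2"
  have "n \<noteq> 0" using assms by (simp add: n_def)
  have wv: "cinner w v = cnj b" by (metis b_def cinner_commute)
  have "cinner (v - (b / of_real n) *\<^sub>C w) (v - (b / of_real n) *\<^sub>C w) =
     of_real ((norm v)\<^sup>2) - (b / of_real n) * cnj b - cnj (b / of_real n) * b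
       + (b / of_real n) * cnj (b / of_real n) * of_real n"
    unfolding n_def cinner_self[symmetric]
    by (simp add: cinner_simps wv b_def[symmetric] algebra_simps)
  also have "\<dots> = of_real ((norm v)\<^sup>2) - b * cnj b / of_real n"
    using \<open>n \<noteq> 0\<close> by (simp add: field_simps)
  also have "\<dots> = of_real ((norm v)\<^sup>2 - (cmod b)\<^sup>2 / n)"
    unfolding complex_norm_square[symmetric] by simp
  finally show ?thesis unfolding b_def n_def cinner_self of_real_eq_iff .
qed

lemma parallelogram:
  "(norm (x + y))\<^sup>2 + (norm (x - y))\<^sup>2 = 2 * (norm x)\<^sup>2 + 2 * (norm (y::'a::complex_inner))\<^sup>2"
  unfolding Re_cinner_self[symmetric] by (simp add: cinner_simps)

lemma subspace_closure:
  fixes S :: "'a::real_normed_vector set"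
  assumes "subspace S"
  shows "subspace (closure S)"
proof (rule subspaceI)
  show "0 \<in> closure S" using subspace_0[OF assms] closure_subset by blast
next
  fix x y assume "x \<in> closure S" "y \<in> closure S"
  then obtain f g where "\<And>n. f n \<in> S" "f \<longlonglongrightarrow> x" "\<And>n. g n \<in> S" "g \<longlonglongrightarrow> y"
    unfolding closure_sequential by blast
  then show "x + y \<in> closure S"
    unfolding closure_sequential
    by (intro exI[of _ "\<lambda>n. f n + g n"] conjI allI subspace_add[OF assms] tendsto_add) auto
next
  fix r x assume "x \<in> closure S"
  then obtain f where "\<And>n. f n \<in> S" "f \<longlonglongrightarrow> x"
    unfolding closure_sequential by blast
  then show "r *\<^sub>R x \<in> closure S"
    unfolding closure_sequential
    by (intro exI[of _ "\<lambda>n. r *\<^sub>R f n"] conjI allI subspace_scale[OF assms] tendsto_scaleR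
        tendsto_const) auto
qed

text \<open>A minimizing sequence for the distance from \<open>x\<close> to \<open>M\<close> is
  Cauchy by the parallelogram law, and its limit is the foot of the perpendicular. Since
  \<open>subspace\<close> is a real notion, closure under complex scalars is assumed
  separately.\<close>

lemma orthogonal_projection:
  fixes M :: "'a::chilbert_space set"
  assumes "closed M" "subspace M" and scaleC: "\<And>c u. u \<in> M \<Longrightarrow> c *\<^sub>C u \<in> M"
  obtains m where "m \<in> M" "\<And>w. w \<in> M \<Longrightarrow> cinner (x - m) w = 0"
proof -
  define d where "d = infdist x M"
  have ne: "M \<noteq> {}" using subspace_0[OF assms(2)] by auto
  have d0: "0 \<le> d" by (simp add: d_def infdist_nonneg)
  have dle: "d\<^sup>2 \<le> (norm (x - u))\<^sup>2" if "u \<in> M" for u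
    using infdist_le[OF that, of x] d0 by (simp add: d_def dist_norm power_mono)
  \<comment> \<open>The error is measured on squared distances because the parallelogram law is used
    on squares.\<close>
  have "\<exists>u\<in>M. (norm (x - u))\<^sup>2 < d\<^sup>2 + 1 / real (Suc n)" for n
  proof -
    have "d < sqrt (d\<^sup>2 + 1 / real (Suc n))"
      by (rule real_less_rsqrt) simp
    then obtain u where "u \<in> M" "dist x u < sqrt (d\<^sup>2 + 1 / real (Suc n))"
      using infdist_notempty[OF ne, of x] cInf_lessD[of "dist x ` M"] ne unfolding d_def by force
    then have "sqrt ((norm (x - u))\<^sup>2) < sqrt (d\<^sup>2 + 1 / real (Suc n))" by (simp add: dist_norm)
    then show ?thesis using \<open>u \<in> M\<close> unfolding real_sqrt_less_iff by blast
  qed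
  then obtain u where uM: "\<And>n. u n \<in> M"
    and u: "\<And>n. (norm (x - u n))\<^sup>2 < d\<^sup>2 + 1 / real (Suc n)"
    by metis
  have close: "(norm (u m - u n))\<^sup>2 \<le> 2 / real (Suc m) + 2 / real (Suc n)" for m n
  proof -
    \<comment> \<open>The midpoint is again at distance at least \<open>d\<close> from
      \<open>x\<close>, which leaves little room for \<open>u m - u n\<close> in the parallelogram
      law.\<close>
    have "(1/2) *\<^sub>R (u m + u n) \<in> M"
      by (intro subspace_scale subspace_add assms uM)
    from dle[OF this] have "4 * d\<^sup>2 \<le> (2 * norm (x - (1/2) *\<^sub>R (u m + u n)))\<^sup>2"
      by (simp add: power_mult_distrib)
    also have "2 * norm (x - (1/2) *\<^sub>R (u m + u n)) = norm ((x - u m) + (x - u n))"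
    proof -
      have "(x - u m) + (x - u n) = 2 *\<^sub>R (x - (1/2) *\<^sub>R (u m + u n))"
        by (simp add: algebra_simps scaleR_2)
      then show ?thesis by (metis norm_scaleR abs_numeral)
    qed
    finally have "4 * d\<^sup>2 + (norm (u n - u m))\<^sup>2 \<le> 2 * (norm (x - u m))\<^sup>2 + 2 * (norm (x - u n))\<^sup>2"
      using parallelogram[of "x - u m" "x - u n"] by simp
    then show ?thesis using u[of m] u[of n] by (simp add: norm_minus_commute)
  qed
  have "Cauchy u"
  proof (rule metric_CauchyI)
    fix e :: real assume "0 < e"
    \<comment> \<open>The bound \<open>close\<close> has two terms, and this \<open>N\<close> keeps
      each below half of \<open>e\<^sup>2\<close>.\<close>
    then obtain N where N: "1 / real (Suc N) < e\<^sup>2 / 4"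
      using nat_approx_posE[of "e\<^sup>2 / 4"] by (metis zero_less_power zero_less_divide_iff zero_less_numeral)
    have "dist (u m) (u n) < e" if "N \<le> m" "N \<le> n" for m n
    proof -
      have "1 / real (Suc m) \<le> 1 / real (Suc N)" "1 / real (Suc n) \<le> 1 / real (Suc N)"
        using that by (auto simp: field_simps)
      then have "2 / real (Suc m) + 2 / real (Suc n) < e\<^sup>2"
        using N by linarith
      then have "(norm (u m - u n))\<^sup>2 < e\<^sup>2"
        using close[of m n] by linarith
      then show ?thesis using \<open>0 < e\<close> by (simp add: dist_norm power_less_imp_less_base)
    qed
    then show "\<exists>N. \<forall>m\<ge>N. \<forall>n\<ge>N. dist (u m) (u n) < e" by blast
  qed
  then obtain m where lim: "u \<longlonglongrightarrow> m" using convergent_eq_Cauchy[of u] by blast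
  have mM: "m \<in> M" using closed_sequentially[OF assms(1)] uM lim by blast
  have "(norm (x - m))\<^sup>2 \<le> d\<^sup>2 + 0"
  proof (rule LIMSEQ_le)
    show "(\<lambda>n. (norm (x - u n))\<^sup>2) \<longlonglongrightarrow> (norm (x - m))\<^sup>2"
      by (intro tendsto_intros lim)
    show "(\<lambda>n. d\<^sup>2 + 1 / real (Suc n)) \<longlonglongrightarrow> d\<^sup>2 + 0"
      by (intro tendsto_intros LIMSEQ_Suc[OF lim_1_over_n])
  qed (use u less_imp_le in blast)
  then have min: "(norm (x - m))\<^sup>2 \<le> (norm (x - w))\<^sup>2" if "w \<in> M" for w
    using dle[OF that] by linarith
  have "cinner (x - m) w = 0" if "w \<in> M" for w
  proof (cases "w = 0")
    case False
    \<comment> \<open>Shifting \<open>m\<close> by the component of \<open>x - m\<close> along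
      \<open>w\<close> would bring it closer to \<open>x\<close> if that component were
      nonzero.\<close>
    have "m + (cinner (x - m) w / of_real ((norm w)\<^sup>2)) *\<^sub>C w \<in> M"
      by (intro subspace_add assms mM that)
    from min[OF this] have "(cmod (cinner (x - m) w))\<^sup>2 / (norm w)\<^sup>2 \<le> 0"
      using norm_diff_scaleC_square[OF False, of "x - m"] unfolding diff_diff_eq by linarith
    then show ?thesis using False by (simp add: divide_le_0_iff)
  qed simp
  with mM that show thesis by blast
qed

text \<open>For nonzero \<open>f\<close>, take \<open>z\<close> orthogonal to the kernel with
  \<open>f z\<close> nonzero. Every \<open>u\<close> differs from a multiple of \<open>z\<close> by
  a kernel element, so \<open>f\<close> is a multiple of the inner product with \<open>z\<close>.
  The factor is conjugated because \<open>cinner\<close> is antilinear in its second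
  argument.\<close>

lemma Riesz_representation:
  fixes f :: "'a::chilbert_space \<Rightarrow> complex"
  assumes f: "bounded_linear f" and scaleC: "\<And>c x. f (c *\<^sub>C x) = c * f x"
  shows "\<exists>z. \<forall>u. f u = cinner u z"
proof (cases "\<forall>u. f u = 0")
  case True
  then show ?thesis by (intro exI[of _ 0]) simp
next
  case False
  then obtain x where fx: "f x \<noteq> 0" by blast
  note lin = bounded_linear.linear[OF f]
  define M where "M = {u. f u = 0}"
  have "closed M"
    unfolding M_def by (intro closed_Collect_eq continuous_intros
        linear_continuous_on[OF f, of UNIV])
  moreover have "subspace M"
    by (auto simp: subspace_def M_def linear_0[OF lin] linear_add[OF lin] linear_scale[OF lin])
  moreover have "c *\<^sub>C u \<in> M" if "u \<in> M" for c u using that by (simp add: M_def scaleC)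
  ultimately obtain m where m: "m \<in> M" "\<And>w. w \<in> M \<Longrightarrow> cinner (x - m) w = 0"
    using orthogonal_projection by metis
  define z where "z = x - m"
  have fz: "f z \<noteq> 0" using fx m(1) by (simp add: z_def M_def linear_diff[OF lin])
  then have "z \<noteq> 0" using linear_0[OF lin] by auto
  have "f u = cinner u ((cnj (f z) / of_real ((norm z)\<^sup>2)) *\<^sub>C z)" for u
  proof -
    have "u - (f u / f z) *\<^sub>C z \<in> M"
      using fz by (simp add: M_def linear_diff[OF lin] scaleC)
    then have "cinner (u - (f u / f z) *\<^sub>C z) z = 0"
      using m(2) by (metis z_def cinner_commute complex_cnj_zero)
    then have "cinner u z = f u / f z * of_real ((norm z)\<^sup>2)"
      by (simp add: cinner_simps cinner_self)
    then show ?thesis using fz \<open>z \<noteq> 0\<close> by (simp add: cinner_simps field_simps)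
  qed
  then show ?thesis by blast
qed

text \<open>Riesz representation supplies \<open>B y\<close> for each \<open>y\<close>, and
  linearity follows because the inner product separates points. Boundedness comes from evaluating
  \<open>A\<close> at \<open>B x\<close>: the square of the norm of \<open>B x\<close> is
  \<open>cinner (A (B x)) x\<close>.\<close>

lemma cadjoint_exists:
  fixes A :: "'a::chilbert_space \<Rightarrow> 'a"
  assumes A: "bounded_clinear A"
  shows "\<exists>B. bounded_clinear B \<and> (\<forall>x y. cinner (A x) y = cinner x (B y))"
proof -
  have "\<exists>z. \<forall>x. cinner (A x) y = cinner x z" for y
  proof (rule Riesz_representation)
    show "bounded_linear (\<lambda>x. cinner (A x) y)"
      by (rule bounded_linear_compose[OF bounded_bilinear.bounded_linear_left[OF
            bounded_bilinear_cinner] bounded_clinear_bounded_linear[OF A]])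
  qed (simp add: bounded_clinear_simps[OF A] cinner_simps)
  then obtain B where B: "\<And>x y. cinner (A x) y = cinner x (B y)" by metis
  obtain K where K: "0 \<le> K" "\<And>x. norm (A x) \<le> K * norm x"
    using bounded_linear.nonneg_bounded[OF bounded_clinear_bounded_linear[OF A]]
    by (metis mult.commute)
  have "bounded_linear B"
  proof (rule bounded_linear_intro[where K = K])
    fix x y r
    show "B (x + y) = B x + B y" by (rule cinner_ext) (simp add: cinner_simps flip: B)
    show "B (r *\<^sub>R x) = r *\<^sub>R B x" by (rule cinner_ext) (simp add: cinner_simps flip: B)
    have "(norm (B x))\<^sup>2 = Re (cinner (A (B x)) x)" by (simp add: B Re_cinner_self)
    also have "\<dots> \<le> norm (A (B x)) * norm x"
      using complex_Re_le_cmod cmod_cinner_le order_trans by blast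
    also have "\<dots> \<le> K * norm (B x) * norm x" by (intro mult_right_mono K) simp
    finally have "norm (B x) * norm (B x) \<le> (norm x * K) * norm (B x)"
      by (simp add: power2_eq_square mult_ac)
    then show "norm (B x) \<le> norm x * K"
      using K(1) by (cases "B x = 0") (simp_all add: mult_le_cancel_right)
  qed
  moreover have "B (c *\<^sub>C x) = c *\<^sub>C B x" for c x
    by (rule cinner_ext) (simp add: cinner_simps flip: B)
  ultimately show ?thesis using B by (auto simp: bounded_clinear_def)
qed

text \<open>Uniqueness of adjoints, which evaluates the definite description.\<close>

lemma cadjoint_eqI:
  assumes "bounded_clinear B" "\<And>x y. cinner (A x) y = cinner x (B y)"
  shows "cadjoint A = B"
  unfolding cadjoint_def
proof (rule the_equality)
  fix C assume C: "bounded_clinear C \<and> (\<forall>x y. cinner (A x) y = cinner x (C y))"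
  show "C = B"
  proof
    fix y
    show "C y = B y"
      by (rule cinner_ext) (use C assms(2) in metis)
  qed
qed (use assms in blast)

lemma
  assumes "bounded_clinear A"
  shows bounded_clinear_cadjoint: "bounded_clinear (cadjoint A)"
    and cinner_cadjoint: "cinner (A x) y = cinner x (cadjoint A y)"
  using cadjoint_exists[OF assms] cadjoint_eqI[of _ A] by metis+

lemma cadjoint_cadjoint:
  assumes "bounded_clinear A"
  shows "cadjoint (cadjoint A) = A"
  using assms by (rule cadjoint_eqI) (metis cinner_cadjoint[OF assms] cinner_commute)

lemma positive_op_cadjoint_comp:
  assumes "bounded_clinear A"
  shows "positive_op (cadjoint A \<circ> A)"
proof (rule positive_opI)
  show "bounded_clinear (cadjoint A \<circ> A)"
    unfolding comp_def by (rule bounded_clinear_comp[OF bounded_clinear_cadjoint[OF assms] assms])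
  have *: "cinner (cadjoint A u) v = cinner u (A v)" for u v
    by (metis cinner_cadjoint[OF assms] cinner_commute)
  show "cinner ((cadjoint A \<circ> A) x) y = cinner x ((cadjoint A \<circ> A) y)" for x y
    by (simp add: * flip: cinner_cadjoint[OF assms])
  show "0 \<le> Re (cinner ((cadjoint A \<circ> A) x) x)" for x
    by (simp add: * cinner_nonneg)
qed

section \<open>Square roots of positive operators\<close>

text \<open>The iteration \<open>Y \<mapsto> (K + Y\<^sup>2) / 2\<close> solves \<open>(1 - Y)\<^sup>2 = 1 - K\<close>. Its increments are dominated
  by those of the scalar iteration for \<open>K = 1\<close>, so it converges in norm for every contraction.\<close>

primrec root_iter :: "('a::real_vector \<Rightarrow> 'a) \<Rightarrow> nat \<Rightarrow> 'a \<Rightarrow> 'a" where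
  "root_iter K 0 = (\<lambda>x. 0)"
| "root_iter K (Suc n) = (\<lambda>x. (1/2) *\<^sub>R (K x + root_iter K n (root_iter K n x)))"

primrec scalar_iter :: "nat \<Rightarrow> real" where
  "scalar_iter 0 = 0"
| "scalar_iter (Suc n) = (1 + (scalar_iter n)\<^sup>2) / 2"

lemma scalar_iter_bounds: "0 \<le> scalar_iter n \<and> scalar_iter n \<le> 1"
  by (induction n) (auto simp: abs_square_le_1 power_le_one)

text \<open>The increment is half the square of \<open>1 - scalar_iter n\<close>.\<close>

lemma scalar_iter_mono: "scalar_iter n \<le> scalar_iter (Suc n)"
  using sum_squares_ge_zero[of "1 - scalar_iter n" 0] by (simp add: power2_eq_square algebra_simps)

lemma scalar_iter_convergent: "convergent scalar_iter"
  by (rule Bseq_mono_convergent)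
    (auto simp: scalar_iter_bounds intro!: BseqI'[where K = 1] lift_Suc_mono_le scalar_iter_mono)

text \<open>The bounds on the increments telescope, so \<open>f\<close> inherits the Cauchy property
  from \<open>g\<close>.\<close>

lemma convergent_dominated_increments:
  fixes f :: "nat \<Rightarrow> 'a::{real_normed_vector, complete_space}" and g :: "nat \<Rightarrow> real"
  assumes "convergent g" "\<And>n. norm (f (Suc n) - f n) \<le> (g (Suc n) - g n) * C"
  shows "convergent f"
proof -
  obtain l where "g \<longlonglongrightarrow> l" using assms(1) by (auto simp: convergent_def)
  then have "Cauchy (\<lambda>n. g n * C)" by (intro LIMSEQ_imp_Cauchy[of _ "l * C"] tendsto_intros)
  have step: "norm (f (n + k) - f n) \<le> (g (n + k) - g n) * C" for n k
  proof (induction k)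
    case (Suc k)
    have "f (n + Suc k) - f n = (f (Suc (n + k)) - f (n + k)) + (f (n + k) - f n)" by simp
    then have "norm (f (n + Suc k) - f n) \<le> norm (f (Suc (n + k)) - f (n + k)) + norm (f (n + k) - f n)"
      by (metis norm_triangle_ineq)
    with Suc assms(2)[of "n + k"] show ?case by (simp add: algebra_simps)
  qed simp
  have "Cauchy f"
  proof (rule CauchyI')
    fix e :: real assume "0 < e"
    then obtain N where N: "\<And>m n. N \<le> m \<Longrightarrow> N \<le> n \<Longrightarrow> dist (g m * C) (g n * C) < e"
      using \<open>Cauchy (\<lambda>n. g n * C)\<close> unfolding Cauchy_def by blast
    have "dist (f m) (f n) < e" if "N \<le> m" "m < n" for m n
    proof -
      have "norm (f n - f m) \<le> (g n - g m) * C" using step[of m "n - m"] that by simp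
      also have "\<dots> \<le> dist (g n * C) (g m * C)" by (simp add: dist_real_def algebra_simps)
      also have "\<dots> < e" using that by (intro N) auto
      finally show ?thesis by (simp add: dist_norm norm_minus_commute)
    qed
    then show "\<exists>M. \<forall>m\<ge>M. \<forall>n>m. dist (f m) (f n) < e" by blast
  qed
  then show ?thesis by (simp add: Cauchy_convergent_iff)
qed

text \<open>For a contraction \<open>K\<close> this is the solution Y of the fixpoint equation, so 1
  - Y is a square root of 1 - K.\<close>

definition contraction_root :: "('a::real_normed_vector \<Rightarrow> 'a) \<Rightarrow> 'a \<Rightarrow> 'a"
  where "contraction_root K x = lim (\<lambda>n. root_iter K n x)"

context
  fixes K :: "'a::chilbert_space \<Rightarrow> 'a"
  assumes K: "bounded_clinear K" and contr: "\<And>x. norm (K x) \<le> norm x"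
begin

lemma root_iter_bounded_clinear: "bounded_clinear (root_iter K n)"
proof (induction n)
  case (Suc n)
  show ?case
    unfolding root_iter.simps
    by (rule bounded_clinear_scaleR[OF bounded_clinear_add[OF K bounded_clinear_comp[OF Suc Suc]]])
qed (simp add: bounded_clinear_zero)

lemma root_iter_norm: "norm (root_iter K n x) \<le> scalar_iter n * norm x"
proof (induction n arbitrary: x)
  case (Suc n)
  have "norm (root_iter K n (root_iter K n x)) \<le> scalar_iter n * (scalar_iter n * norm x)"
    using scalar_iter_bounds by (intro order_trans[OF Suc] mult_left_mono Suc) auto
  then have "norm (K x + root_iter K n (root_iter K n x)) \<le> norm x + (scalar_iter n)\<^sup>2 * norm x"
    using contr[of x] by (intro norm_triangle_le) (simp add: power2_eq_square mult.assoc)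
  then show ?case unfolding root_iter.simps norm_scaleR by (simp add: field_simps)
qed simp

lemma root_iter_norm_le: "norm (root_iter K n x) \<le> norm x"
  using order_trans[OF root_iter_norm mult_right_mono[of "scalar_iter n" 1 "norm x"]]
  by (simp add: scalar_iter_bounds)

text \<open>With Y and Z consecutive iterates, Z^2 - Y^2 = Z (Z - Y) + (Z - Y) Y, a splitting that
  requires no commutation. The scalar bounds of the two terms add up to z^2 - y^2.\<close>

lemma root_iter_increment:
  "norm (root_iter K (Suc n) x - root_iter K n x) \<le> (scalar_iter (Suc n) - scalar_iter n) * norm x"
proof (induction n arbitrary: x)
  case 0
  then show ?case using contr[of x] by simp
next
  case (Suc n)
  define Y Z where "Y = root_iter K n" and "Z = root_iter K (Suc n)"
  define y z where "y = scalar_iter n" and "z = scalar_iter (Suc n)"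
  note Z = root_iter_bounded_clinear[of "Suc n", folded Z_def]
  have IH: "norm (Z x - Y x) \<le> (z - y) * norm x" for x
    using Suc by (simp only: Y_def Z_def y_def z_def)
  have "0 \<le> y" "0 \<le> z" "0 \<le> z - y"
    unfolding y_def z_def using scalar_iter_bounds scalar_iter_mono by (auto simp del: scalar_iter.simps)
  have "norm (Z (Z x - Y x)) \<le> z * ((z - y) * norm x)"
    unfolding Z_def z_def
    by (rule order_trans[OF root_iter_norm])
      (use IH scalar_iter_bounds in \<open>auto simp: Z_def z_def simp del: scalar_iter.simps root_iter.simps
        intro!: mult_left_mono\<close>)
  moreover have "norm (Z (Y x) - Y (Y x)) \<le> (z - y) * (y * norm x)"
    by (rule order_trans[OF IH]) (use \<open>0 \<le> z - y\<close> root_iter_norm in \<open>auto simp: Y_def y_def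
        intro!: mult_left_mono\<close>)
  ultimately have "norm (Z (Z x - Y x) + (Z (Y x) - Y (Y x)))
      \<le> z * ((z - y) * norm x) + (z - y) * (y * norm x)"
    by (rule norm_triangle_mono)
  moreover have incr: "root_iter K (Suc (Suc n)) x - root_iter K (Suc n) x
      = (1/2) *\<^sub>R (Z (Z x - Y x) + (Z (Y x) - Y (Y x)))"
  proof -
    have "root_iter K (Suc (Suc n)) x = (1/2) *\<^sub>R (K x + Z (Z x))"
      "root_iter K (Suc n) x = (1/2) *\<^sub>R (K x + Y (Y x))"
      by (simp_all only: Y_def Z_def root_iter.simps)
    then show ?thesis by (simp add: bounded_clinear_simps[OF Z] flip: scaleR_diff_right)
  qed
  moreover have incr': "scalar_iter (Suc (Suc n)) - scalar_iter (Suc n) = (z\<^sup>2 - y\<^sup>2) / 2"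
    unfolding scalar_iter.simps(2)[of "Suc n"] z_def[symmetric]
    by (simp add: z_def y_def field_simps)
  ultimately show ?case
    unfolding incr incr' norm_scaleR by (simp add: power2_eq_square field_simps)
qed

lemma contraction_root_lim: "(\<lambda>n. root_iter K n x) \<longlonglongrightarrow> contraction_root K x"
proof -
  have "convergent (\<lambda>n. root_iter K n x)"
    by (rule convergent_dominated_increments[OF scalar_iter_convergent, where C = "norm x"])
      (rule root_iter_increment)
  then show ?thesis unfolding contraction_root_def convergent_LIMSEQ_iff .
qed

lemma contraction_root_norm: "norm (contraction_root K x) \<le> norm x"
  by (rule LIMSEQ_le_const2[OF tendsto_norm[OF contraction_root_lim]])
    (use root_iter_norm_le in blast)

lemma contraction_root_bounded_clinear: "bounded_clinear (contraction_root K)"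
proof -
  have "bounded_linear (contraction_root K)"
  proof (rule bounded_linear_intro[where K = 1])
    fix x y r
    show "contraction_root K (x + y) = contraction_root K x + contraction_root K y"
      using LIMSEQ_unique[OF contraction_root_lim]
        tendsto_add[OF contraction_root_lim[of x] contraction_root_lim[of y]]
      by (simp add: bounded_clinear_simps[OF root_iter_bounded_clinear])
    show "contraction_root K (r *\<^sub>R x) = r *\<^sub>R contraction_root K x"
      using LIMSEQ_unique[OF contraction_root_lim]
        tendsto_scaleR[OF tendsto_const contraction_root_lim[of x], of r]
      by (simp add: bounded_clinear_simps[OF root_iter_bounded_clinear])
  qed (simp add: contraction_root_norm)
  moreover have "contraction_root K (c *\<^sub>C x) = c *\<^sub>C contraction_root K x" for c x
    using LIMSEQ_unique[OF contraction_root_lim]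
      bounded_linear.tendsto[OF bounded_linear_scaleC contraction_root_lim[of x], of c]
    by (simp add: bounded_clinear_simps[OF root_iter_bounded_clinear])
  ultimately show ?thesis by (simp add: bounded_clinear_def)
qed

lemma contraction_root_fixpoint:
  "contraction_root K x = (1/2) *\<^sub>R (K x + contraction_root K (contraction_root K x))"
proof -
  let ?Y = "contraction_root K"
  \<comment> \<open>Operator and argument vary together; the limit still passes because all iterates
    are contractions.\<close>
  have "(\<lambda>n. norm (root_iter K n (root_iter K n x - ?Y x))) \<longlonglongrightarrow> 0"
  proof (rule tendsto_sandwich[OF _ _ tendsto_const])
    show "(\<lambda>n. norm (root_iter K n x - ?Y x)) \<longlonglongrightarrow> 0"
      using tendsto_norm_zero[OF LIM_zero[OF contraction_root_lim]] .
  qed (auto simp: root_iter_norm_le)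
  then have "(\<lambda>n. root_iter K n (root_iter K n x - ?Y x) + root_iter K n (?Y x)) \<longlonglongrightarrow> 0 + ?Y (?Y x)"
    by (intro tendsto_add contraction_root_lim) (simp add: tendsto_norm_zero_iff)
  then have "(\<lambda>n. root_iter K n (root_iter K n x)) \<longlonglongrightarrow> ?Y (?Y x)"
    by (simp add: bounded_clinear_simps[OF root_iter_bounded_clinear])
  then have "(\<lambda>n. root_iter K (Suc n) x) \<longlonglongrightarrow> (1/2) *\<^sub>R (K x + ?Y (?Y x))"
    unfolding root_iter.simps by (intro tendsto_scaleR tendsto_add tendsto_const)
  from LIMSEQ_unique[OF LIMSEQ_Suc[OF contraction_root_lim] this] show ?thesis .
qed

lemma contraction_root_hermitian:
  assumes herm: "\<And>x y. cinner (K x) y = cinner x (K y)"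
  shows "cinner (contraction_root K x) y = cinner x (contraction_root K y)"
proof -
  have iter: "cinner (root_iter K n x) y = cinner x (root_iter K n y)" for n x y
    by (induction n arbitrary: x y) (simp_all add: cinner_simps herm)
  have "(\<lambda>n. cinner (root_iter K n x) y) \<longlonglongrightarrow> cinner (contraction_root K x) y"
    by (rule bounded_bilinear.tendsto[OF bounded_bilinear_cinner contraction_root_lim tendsto_const])
  moreover have "(\<lambda>n. cinner x (root_iter K n y)) \<longlonglongrightarrow> cinner x (contraction_root K y)"
    by (rule bounded_bilinear.tendsto[OF bounded_bilinear_cinner tendsto_const contraction_root_lim])
  ultimately show ?thesis unfolding iter by (rule LIMSEQ_unique)
qed

end

text \<open>Each iterate is a polynomial in the operator, so the intertwining relation carries over
  to the iterates and then to the limit.\<close>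

lemma contraction_root_intertwine:
  fixes K L :: "'a::chilbert_space \<Rightarrow> 'a"
  assumes "bounded_clinear K" "\<And>x. norm (K x) \<le> norm x"
    and "bounded_clinear L" "\<And>x. norm (L x) \<le> norm x"
    and A: "bounded_clinear A" and AK: "\<And>x. A (K x) = L (A x)"
  shows "A (contraction_root K x) = contraction_root L (A x)"
proof -
  have "A (root_iter K n x) = root_iter L n (A x)" for n x
    by (induction n arbitrary: x) (simp_all add: bounded_clinear_simps[OF A] AK)
  then have "(\<lambda>n. root_iter L n (A x)) \<longlonglongrightarrow> A (contraction_root K x)"
    using bounded_linear.tendsto[OF bounded_clinear_bounded_linear[OF A]
        contraction_root_lim[OF assms(1,2)], of x] by simp
  then show ?thesis using LIMSEQ_unique contraction_root_lim[OF assms(3,4)] by blast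
qed

section \<open>Scaling from contractions to arbitrary positive operators\<close>

definition scaled_complement :: "real \<Rightarrow> ('a::real_vector \<Rightarrow> 'a) \<Rightarrow> 'a \<Rightarrow> 'a"
  where "scaled_complement c T x = x - (1/c) *\<^sub>R T x"

text \<open>With K = 1 - T/c one has T = c (1 - K), so this is the root of 1 - K rescaled to a root
  of T. The constant \<open>c\<close> is meant to be any positive norm bound of
  \<open>T\<close>.\<close>

definition scaled_root :: "real \<Rightarrow> ('a::real_normed_vector \<Rightarrow> 'a) \<Rightarrow> 'a \<Rightarrow> 'a"
  where "scaled_root c T x = sqrt c *\<^sub>R (x - contraction_root (scaled_complement c T) x)"

context
  fixes T :: "'a::chilbert_space \<Rightarrow> 'a" and c :: real
  assumes T: "positive_op T" and c: "0 < c" and bound: "\<And>x. norm (T x) \<le> c * norm x"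
begin

lemma scaled_complement_bounded_clinear: "bounded_clinear (scaled_complement c T)"
  unfolding scaled_complement_def
  by (intro bounded_clinear_diff bounded_clinear_ident bounded_clinear_scaleR
      positive_op_bounded_clinear T)

text \<open>Expand the square: by T^2 <= c T the quadratic term is at most half of the cross term,
  so a nonnegative amount is subtracted.\<close>

lemma scaled_complement_contraction: "norm (scaled_complement c T x) \<le> norm x"
proof -
  have sym: "cinner x (T x) = cinner (T x) x" by (simp add: positive_op_hermitian[OF T])
  have le: "(norm (T x))\<^sup>2 / c\<^sup>2 \<le> c * Re (cinner (T x) x) / c\<^sup>2"
    by (intro divide_right_mono positive_op_norm_square_le T bound) simp
  have "(norm (scaled_complement c T x))\<^sup>2 =
      (norm x)\<^sup>2 - 2 / c * Re (cinner (T x) x) + (norm (T x))\<^sup>2 / c\<^sup>2"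
    unfolding scaled_complement_def Re_cinner_self[symmetric]
    by (simp add: cinner_simps sym power2_eq_square diff_divide_distrib)
  also have "\<dots> \<le> (norm x)\<^sup>2 - 2 / c * Re (cinner (T x) x) + c * Re (cinner (T x) x) / c\<^sup>2"
    using le by simp
  also have "\<dots> = (norm x)\<^sup>2 - Re (cinner (T x) x) / c"
    using c by (simp add: field_simps power2_eq_square)
  also have "\<dots> \<le> (norm x)\<^sup>2"
    using positive_op_Re[OF T] c by simp
  finally show ?thesis by (rule power2_le_imp_le) simp
qed

lemma scaled_root_positive: "positive_op (scaled_root c T)"
proof (rule positive_opI)
  note Y = scaled_complement_bounded_clinear scaled_complement_contraction
  have herm: "cinner (scaled_complement c T x) y = cinner x (scaled_complement c T y)" for x y
    by (simp add: scaled_complement_def cinner_simps positive_op_hermitian[OF T])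
  show "bounded_clinear (scaled_root c T)"
    unfolding scaled_root_def
    by (intro bounded_clinear_scaleR bounded_clinear_diff bounded_clinear_ident
        contraction_root_bounded_clinear Y)
  show "cinner (scaled_root c T x) y = cinner x (scaled_root c T y)" for x y
    by (simp add: scaled_root_def cinner_simps contraction_root_hermitian[OF Y herm])
  fix x
  have "Re (cinner (contraction_root (scaled_complement c T) x) x)
      \<le> norm (contraction_root (scaled_complement c T) x) * norm x"
    using complex_Re_le_cmod cmod_cinner_le order_trans by blast
  also have "\<dots> \<le> norm x * norm x"
    by (intro mult_right_mono contraction_root_norm Y) simp
  finally show "0 \<le> Re (cinner (scaled_root c T x) x)"
    using c by (simp add: scaled_root_def cinner_simps Re_cinner_self power2_eq_square)
qed

lemma scaled_root_square: "scaled_root c T (scaled_root c T x) = T x"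
proof -
  note Y = scaled_complement_bounded_clinear scaled_complement_contraction
  let ?Y = "contraction_root (scaled_complement c T)"
  have "scaled_root c T (scaled_root c T x) = c *\<^sub>R (x - 2 *\<^sub>R ?Y x + ?Y (?Y x))"
    using c by (simp add: scaled_root_def bounded_clinear_simps[OF contraction_root_bounded_clinear[OF Y]]
        scaleR_2 algebra_simps)
  also have "?Y (?Y x) = 2 *\<^sub>R ?Y x - scaled_complement c T x"
    \<comment> \<open>The fixpoint equation read as Y^2 = 2 Y - K.\<close>
    by (subst (3) contraction_root_fixpoint[OF Y]) simp
  also have "c *\<^sub>R (x - 2 *\<^sub>R ?Y x + (2 *\<^sub>R ?Y x - scaled_complement c T x)) = T x"
    using c by (simp add: scaled_complement_def)
  finally show ?thesis .
qed

end

text \<open>Both roots use the same \<open>c\<close>, so that the relation passes to the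
  complements.\<close>

lemma scaled_root_intertwine:
  fixes S T :: "'a::chilbert_space \<Rightarrow> 'a"
  assumes c: "0 < c" and S: "positive_op S" "\<And>x. norm (S x) \<le> c * norm x"
    and T: "positive_op T" "\<And>x. norm (T x) \<le> c * norm x"
    and A: "bounded_clinear A" and AS: "\<And>x. A (S x) = T (A x)"
  shows "A (scaled_root c S x) = scaled_root c T (A x)"
proof -
  have "A (contraction_root (scaled_complement c S) x)
      = contraction_root (scaled_complement c T) (A x)"
    by (intro contraction_root_intertwine scaled_complement_bounded_clinear
        scaled_complement_contraction assms)
      (simp add: scaled_complement_def bounded_clinear_simps[OF A] AS)
  then show ?thesis by (simp add: scaled_root_def bounded_clinear_simps[OF A])
qed

text \<open>Put y = (P - Q) x. Commutation gives (P + Q) y = (P^2 - Q^2) x = 0, so both nonnegative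
  forms vanish at y and P y = Q y = 0. Hence the inner product of y with itself, moved onto x, is
  zero.\<close>

lemma positive_root_unique:
  assumes P: "positive_op P" and Q: "positive_op Q"
    and sq: "\<And>x. P (P x) = Q (Q x)" and comm: "\<And>x. P (Q x) = Q (P x)"
  shows "P = Q"
proof
  fix x
  note lin = bounded_clinear_simps[OF positive_op_bounded_clinear[OF P]]
    bounded_clinear_simps[OF positive_op_bounded_clinear[OF Q]]
  define y where "y = P x - Q x"
  have "P y + Q y = 0" by (simp add: y_def lin sq comm)
  then have "Re (cinner (P y) y) + Re (cinner (Q y) y) = 0"
    by (metis cinner_add_left cinner_zero_left plus_complex.sel(1) zero_complex.sel(1))
  then have "P y = 0" "Q y = 0"
    using positive_op_Re[OF P, of y] positive_op_Re[OF Q, of y] by (auto intro: positive_op_eq_0 P Q)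
  moreover have "cinner y y = cinner x (P y - Q y)"
    by (simp add: y_def lin cinner_simps positive_op_hermitian[OF P] positive_op_hermitian[OF Q])
  ultimately have "y = 0" by (simp add: cinner_eq_zero_iff)
  then show "P x = Q x" by (simp add: y_def)
qed

text \<open>Any positive root \<open>Q\<close> commutes with \<open>T\<close>, its square, hence
  with \<open>scaled_root c T\<close> by intertwining; uniqueness for commuting roots then
  applies.\<close>

lemma sqrt_op_eq_scaled_root:
  fixes T :: "'a::chilbert_space \<Rightarrow> 'a"
  assumes "positive_op T" "0 < c" "\<And>x. norm (T x) \<le> c * norm x"
  shows "sqrt_op T = scaled_root c T"
  unfolding sqrt_op_def
proof (rule the_equality)
  show "positive_op (scaled_root c T) \<and> scaled_root c T \<circ> scaled_root c T = T"
    using scaled_root_positive[OF assms] scaled_root_square[OF assms] by auto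
next
  fix Q assume Q: "positive_op Q \<and> Q \<circ> Q = T"
  then have QQ: "Q (Q x) = T x" for x by (auto simp: fun_eq_iff)
  have "Q (scaled_root c T x) = scaled_root c T (Q x)" for x
    by (intro scaled_root_intertwine assms) (use Q in \<open>auto simp: positive_op_def\<close>)
  then show "Q = scaled_root c T"
    using Q QQ scaled_root_positive[OF assms] scaled_root_square[OF assms]
    by (intro positive_root_unique) auto
qed

section \<open>Properties of the square root without reference to a norm bound\<close>

lemma bounded_clinear_pos_bound:
  assumes "bounded_clinear A"
  obtains c where "0 < c" "\<And>x. norm (A x) \<le> c * norm x"
  using bounded_linear.pos_bounded[OF bounded_clinear_bounded_linear[OF assms]]
  by (metis mult.commute)

lemma
  assumes "positive_op T"
  shows sqrt_op_positive: "positive_op (sqrt_op T)"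
    and sqrt_op_square: "sqrt_op T (sqrt_op T x) = T x"
proof -
  obtain c where c: "0 < c" "\<And>x. norm (T x) \<le> c * norm x"
    using bounded_clinear_pos_bound positive_op_bounded_clinear assms by metis
  show "positive_op (sqrt_op T)" "sqrt_op T (sqrt_op T x) = T x"
    using scaled_root_positive[OF assms c] scaled_root_square[OF assms c]
    by (simp_all add: sqrt_op_eq_scaled_root[OF assms c])
qed

lemma sqrt_op_intertwine:
  assumes S: "positive_op S" and T: "positive_op T"
    and A: "bounded_clinear A" and AS: "\<And>x. A (S x) = T (A x)"
  shows "A (sqrt_op S x) = sqrt_op T (A x)"
proof -
  obtain a where a: "0 < a" "\<And>x. norm (S x) \<le> a * norm x"
    using bounded_clinear_pos_bound positive_op_bounded_clinear S by metis
  obtain b where b: "0 < b" "\<And>x. norm (T x) \<le> b * norm x"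
    using bounded_clinear_pos_bound positive_op_bounded_clinear T by metis
  \<comment> \<open>The roots of \<open>S\<close> and \<open>T\<close> have to be built with a
    common bound before they can be intertwined.\<close>
  define c where "c = max a b"
  have c: "0 < c" using a by (simp add: c_def)
  have Sc: "norm (S x) \<le> c * norm x" for x
    by (rule order_trans[OF a(2)]) (simp add: c_def mult_right_mono)
  have Tc: "norm (T x) \<le> c * norm x" for x
    by (rule order_trans[OF b(2)]) (simp add: c_def mult_right_mono)
  show ?thesis
    unfolding sqrt_op_eq_scaled_root[OF S c Sc] sqrt_op_eq_scaled_root[OF T c Tc]
    by (intro scaled_root_intertwine assms c Sc Tc)
qed

lemma sqrt_op_ident: "sqrt_op (\<lambda>x. x) = (\<lambda>x::'a::chilbert_space. x)"
  by (rule positive_root_unique)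
    (simp_all add: positive_op_ident sqrt_op_positive sqrt_op_square)

section \<open>The mixed Schwarz inequality\<close>

lemma abs_op_positive: "bounded_clinear A \<Longrightarrow> positive_op (abs_op A)"
  unfolding abs_op_def by (intro sqrt_op_positive positive_op_cadjoint_comp)

lemma abs_op_square: "bounded_clinear A \<Longrightarrow> abs_op A (abs_op A x) = cadjoint A (A x)"
  unfolding abs_op_def by (simp add: sqrt_op_square positive_op_cadjoint_comp)

text \<open>\<open>A\<close> intertwines \<open>cadjoint A \<circ> A\<close> with
  \<open>A \<circ> cadjoint A\<close> by associativity, and this passes to the square roots.\<close>

lemma abs_op_intertwine:
  assumes A: "bounded_clinear A"
  shows "A (abs_op A x) = abs_op (cadjoint A) (A x)"
  unfolding abs_op_def
  by (intro sqrt_op_intertwine positive_op_cadjoint_comp bounded_clinear_cadjoint A)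
    (simp add: cadjoint_cadjoint[OF A])

lemma mixed_Schwarz:
  assumes A: "bounded_clinear A"
  shows "(cmod (cinner (A x) y))\<^sup>2
    \<le> Re (cinner (abs_op A x) x) * Re (cinner (abs_op (cadjoint A) y) y)"
proof -
  define P Q where "P = abs_op A" and "Q = abs_op (cadjoint A)"
  have P: "positive_op P" and Q: "positive_op Q"
    by (simp_all add: P_def Q_def abs_op_positive A bounded_clinear_cadjoint)
  note Pb = positive_op_bounded_clinear[OF P]
  note PL = bounded_clinear_bounded_linear[OF Pb] and AL = bounded_clinear_bounded_linear[OF A]
  have sq: "P (P u) = cadjoint A (A u)" for u by (simp add: P_def abs_op_square A)
  have AP: "A (P u) = Q (A u)" for u by (simp add: P_def Q_def abs_op_intertwine A)
  \<comment> \<open>With \<open>y\<close> fixed, the vectors satisfying the claim form a closed set,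
    so the range of \<open>P\<close> can be replaced by its closure.\<close>
  define D where "D = {x. (cmod (cinner (A x) y))\<^sup>2 \<le> Re (cinner (P x) x) * Re (cinner (Q y) y)}"
  have "closed D"
    unfolding D_def
    by (intro closed_Collect_le continuous_intros bounded_bilinear.continuous_on[OF bounded_bilinear_cinner]
        linear_continuous_on PL AL)
  moreover have "range P \<subseteq> D"
  proof (clarsimp simp: D_def)
    fix u
    \<comment> \<open>This identifies the first factor in Cauchy-Schwarz for \<open>Q\<close> at
      \<open>A u\<close> with the one wanted for \<open>P\<close> at \<open>P u\<close>.\<close>
    have "cinner (Q (A u)) (A u) = cinner (P (P u)) (P u)"
      unfolding AP[symmetric] cinner_cadjoint[OF A] sq[symmetric]
      by (simp add: positive_op_hermitian[OF P])
    then show "(cmod (cinner (A (P u)) y))\<^sup>2 \<le> Re (cinner (P (P u)) (P u)) * Re (cinner (Q y) y)"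
      using positive_op_Cauchy_Schwarz[OF Q, of "A u" y] by (simp add: AP)
  qed
  ultimately have clD: "closure (range P) \<subseteq> D" by (rule closure_minimal[rotated])
  have "subspace (range P)"
    using bounded_linear.linear[OF PL] by (simp add: linear_subspace_image)
  then have "subspace (closure (range P))" by (rule subspace_closure)
  moreover have "c *\<^sub>C u \<in> closure (range P)" if "u \<in> closure (range P)" for c u
  proof -
    have "(\<lambda>u. c *\<^sub>C u) ` closure (range P) \<subseteq> closure ((\<lambda>u. c *\<^sub>C u) ` range P)"
      by (rule closure_bounded_linear_image_subset[OF bounded_linear_scaleC])
    also have "\<dots> \<subseteq> closure (range P)"
      by (rule closure_mono) (auto simp: bounded_clinear_scaleC[OF Pb, symmetric])
    finally show ?thesis using that by blast
  qed
  ultimately obtain m where m: "m \<in> closure (range P)"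
    "\<And>w. w \<in> closure (range P) \<Longrightarrow> cinner (x - m) w = 0"
    using orthogonal_projection[OF closed_closure] by metis
  have "cinner (P (x - m)) w = 0" for w
    unfolding positive_op_hermitian[OF P] by (intro m(2) subsetD[OF closure_subset] rangeI)
  then have Pz: "P (x - m) = 0" by (metis cinner_eq_zero_iff)
  have "cinner (A (x - m)) (A (x - m)) = cinner (x - m) (P (P (x - m)))"
    by (simp add: sq cinner_cadjoint[OF A])
  then have Az: "A (x - m) = 0"
    unfolding Pz bounded_clinear_simps(3)[OF Pb] by (simp add: cinner_eq_zero_iff)
  \<comment> \<open>Every term of the inequality that involves \<open>x\<close> is unchanged when
    \<open>x\<close> is replaced by its projection \<open>m\<close>.\<close>
  have "A x = A m" "P x = P m" "cinner (P m) x = cinner (P m) m"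
    using Az Pz positive_op_hermitian[OF P, of m "x - m"]
    by (simp_all add: bounded_clinear_simps[OF A] bounded_clinear_simps[OF Pb] cinner_simps)
  moreover have "m \<in> D" using m(1) clD by blast
  ultimately show ?thesis by (simp add: D_def P_def Q_def)
qed

lemma cmod_cinner_le_half_sum:
  assumes A: "bounded_clinear A"
  shows "cmod (cinner (A x) x)
    \<le> (Re (cinner (abs_op A x) x) + Re (cinner (abs_op (cadjoint A) x) x)) / 2"
proof -
  let ?p = "Re (cinner (abs_op A x) x)" and ?q = "Re (cinner (abs_op (cadjoint A) x) x)"
  have nn: "0 \<le> ?p" "0 \<le> ?q"
    by (auto intro!: positive_op_Re abs_op_positive A bounded_clinear_cadjoint)
  have "cmod (cinner (A x) x) \<le> sqrt (?p * ?q)"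
    using mixed_Schwarz[OF A] by (rule real_le_rsqrt)
  also have "\<dots> \<le> (?p + ?q) / 2" using nn by (rule arith_geo_mean_sqrt)
  finally show ?thesis .
qed

section \<open>The numerical radius\<close>

lemma cmod_cinner_le_numerical_radius:
  fixes A :: "'a::chilbert_space \<Rightarrow> 'a"
  assumes "bounded_clinear A" "norm x = 1"
  shows "cmod (cinner (A x) x) \<le> numerical_radius A"
  unfolding numerical_radius_def
proof (rule cSUP_upper)
  obtain c where c: "\<And>x. norm (A x) \<le> c * norm x"
    using bounded_clinear_pos_bound[OF assms(1)] by blast
  have "cmod (cinner (A u) u) \<le> c" if "norm u = 1" for u
    using cmod_cinner_le[of "A u" u] c[of u] that by simp
  then show "bdd_above ((\<lambda>x. cmod (cinner (A x) x)) ` {x. norm x = 1})"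
    by (auto intro!: bdd_aboveI2[where M = c])
qed (simp add: assms)

section \<open>The identity operator, extremal for the constant\<close>

lemma numerical_radius_scaleC_ident:
  assumes "norm (e::'a::chilbert_space) = 1"
  shows "numerical_radius (\<lambda>x::'a. c *\<^sub>C x) = cmod c"
proof -
  have "(\<lambda>x::'a. cmod (cinner (c *\<^sub>C x) x)) ` {x. norm x = 1} = {cmod c}"
    using assms by (auto simp: cinner_simps cinner_self norm_mult image_iff)
  then show ?thesis by (simp add: numerical_radius_def)
qed

lemma cadjoint_ident: "cadjoint (\<lambda>x. x) = (\<lambda>x::'a::chilbert_space. x)"
  by (rule cadjoint_eqI) (simp_all add: bounded_clinear_ident)

lemma abs_op_ident: "abs_op (\<lambda>x. x) = (\<lambda>x::'a::chilbert_space. x)"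
  by (simp add: abs_op_def cadjoint_ident comp_def sqrt_op_ident)

text \<open>Source of the factor 1 / sqrt 2: (p + q)^2 <= 2 (p^2 + q^2), with equality for p =
  q.\<close>

lemma add_div_2_le_cmod:
  fixes p q :: real
  shows "(p + q) / 2 \<le> 1 / sqrt 2 * cmod (Complex p q)"
proof -
  have "(p + q)\<^sup>2 \<le> 2 * (p\<^sup>2 + q\<^sup>2)"
    using zero_le_power2[of "p - q"] by (simp add: power2_eq_square algebra_simps)
  then have "p + q \<le> sqrt 2 * sqrt (p\<^sup>2 + q\<^sup>2)"
    by (metis real_le_rsqrt real_sqrt_mult)
  moreover have "1 / sqrt 2 = sqrt 2 / 2" by (simp add: field_simps)
  ultimately show ?thesis unfolding complex_norm complex.sel by (simp only:) simp
qed

theorem theorem2p1: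
  assumes nonzero: "\<exists>x::'a::chilbert_space. x \<noteq> 0"
  shows
    "(\<forall>A B :: 'a \<Rightarrow> 'a. bounded_clinear A \<longrightarrow> bounded_clinear B \<longrightarrow>
        numerical_radius (\<lambda>x. A x + B x)
          \<le> 1 / sqrt 2 *
            numerical_radius (\<lambda>x. (abs_op A x + abs_op B x)
              + \<i> *\<^sub>C (abs_op (cadjoint A) x + abs_op (cadjoint B) x)))
     \<and> \<not> (\<exists>c::real. c < 1 / sqrt 2 \<and>
        (\<forall>A B :: 'a \<Rightarrow> 'a. bounded_clinear A \<longrightarrow> bounded_clinear B \<longrightarrow>
          numerical_radius (\<lambda>x. A x + B x)
            \<le> c *
              numerical_radius (\<lambda>x. (abs_op A x + abs_op B x)
                + \<i> *\<^sub>C (abs_op (cadjoint A) x + abs_op (cadjoint B) x))))"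
proof -
  obtain v :: 'a where "v \<noteq> 0" using nonzero by blast
  \<comment> \<open>This unit vector makes the supremum range over a nonempty set.\<close>
  then have e: "norm ((1 / norm v) *\<^sub>R v) = 1" by simp
  show ?thesis
  proof (intro conjI allI impI notI)
    fix A B :: "'a \<Rightarrow> 'a"
    assume A: "bounded_clinear A" and B: "bounded_clinear B"
    define T where "T = (\<lambda>x. (abs_op A x + abs_op B x)
      + \<i> *\<^sub>C (abs_op (cadjoint A) x + abs_op (cadjoint B) x))"
    note pos = abs_op_positive[OF A] abs_op_positive[OF B]
      abs_op_positive[OF bounded_clinear_cadjoint[OF A]]
      abs_op_positive[OF bounded_clinear_cadjoint[OF B]]
    have T: "bounded_clinear T"
      unfolding T_def
      by (intro bounded_clinear_add bounded_clinear_scaleC_comp positive_op_bounded_clinear pos)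
    have "cmod (cinner (A x + B x) x) \<le> 1 / sqrt 2 * numerical_radius T" if "norm x = 1" for x
    proof -
      let ?p = "Re (cinner (abs_op A x) x) + Re (cinner (abs_op B x) x)"
      let ?q = "Re (cinner (abs_op (cadjoint A) x) x) + Re (cinner (abs_op (cadjoint B) x) x)"
      have "cmod (cinner (A x + B x) x) \<le> cmod (cinner (A x) x) + cmod (cinner (B x) x)"
        by (simp add: cinner_add_left norm_triangle_ineq)
      also have "\<dots> \<le> (?p + ?q) / 2"
        using cmod_cinner_le_half_sum[OF A, of x] cmod_cinner_le_half_sum[OF B, of x] by simp
      also have "\<dots> \<le> 1 / sqrt 2 * cmod (Complex ?p ?q)" by (rule add_div_2_le_cmod)
      \<comment> \<open>By positivity the four diagonal values are real, so \<open>?p\<close> and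
        \<open>?q\<close> are the real and imaginary parts of \<open>cinner (T x) x\<close>.\<close>
      also have "Complex ?p ?q = cinner (T x) x"
        unfolding T_def cinner_simps
        by (subst (5 6 7 8) positive_op_of_real) (simp_all add: pos complex_eq_iff)
      also have "1 / sqrt 2 * cmod (cinner (T x) x) \<le> 1 / sqrt 2 * numerical_radius T"
        by (intro mult_left_mono cmod_cinner_le_numerical_radius T that) simp
      finally show ?thesis .
    qed
    then show "numerical_radius (\<lambda>x. A x + B x) \<le> 1 / sqrt 2 * numerical_radius T"
      unfolding numerical_radius_def[of "\<lambda>x. A x + B x"] using e by (intro cSUP_least) blast+
  next
    assume "\<exists>c::real. c < 1 / sqrt 2 \<and>
      (\<forall>A B :: 'a \<Rightarrow> 'a. bounded_clinear A \<longrightarrow> bounded_clinear B \<longrightarrow>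
        numerical_radius (\<lambda>x. A x + B x)
          \<le> c * numerical_radius (\<lambda>x. (abs_op A x + abs_op B x)
              + \<i> *\<^sub>C (abs_op (cadjoint A) x + abs_op (cadjoint B) x)))"
    then obtain c :: real where c: "c < 1 / sqrt 2"
      and ineq: "\<And>A B :: 'a \<Rightarrow> 'a. bounded_clinear A \<Longrightarrow> bounded_clinear B \<Longrightarrow>
        numerical_radius (\<lambda>x. A x + B x)
          \<le> c * numerical_radius (\<lambda>x. (abs_op A x + abs_op B x)
              + \<i> *\<^sub>C (abs_op (cadjoint A) x + abs_op (cadjoint B) x))" by blast
    have 1: "x + x = 2 *\<^sub>C x" and 2: "(x + x) + \<i> *\<^sub>C (x + x) = Complex 2 2 *\<^sub>C x" for x :: 'a
    proof -
      show 1: "x + x = 2 *\<^sub>C x" for x :: 'a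
        using scaleC_add_left[of 1 1 x] by (simp add: scaleC_one)
      show "(x + x) + \<i> *\<^sub>C (x + x) = Complex 2 2 *\<^sub>C x"
        unfolding 1[of x] scaleC_scaleC scaleC_add_left[symmetric]
        by (rule arg_cong[where f = "\<lambda>c. c *\<^sub>C x"]) (simp add: complex_eq_iff)
    qed
    \<comment> \<open>For \<open>A = B = 1\<close> the left operator is 2 and the right one is 2 +
      2i, of numerical radius 2 sqrt 2.\<close>
    have "2 \<le> c * (2 * sqrt 2)"
    proof -
      have "cmod (Complex 2 2) = 2 * sqrt 2"
        using real_sqrt_mult[of 4 2] by (simp add: complex_norm)
      then show ?thesis
        using ineq[OF bounded_clinear_ident bounded_clinear_ident]
        \<comment> \<open>Fact \<open>2\<close> must come before \<open>1\<close>, which would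
          rewrite the sums inside its left-hand side.\<close>
        unfolding abs_op_ident cadjoint_ident 2 unfolding 1 numerical_radius_scaleC_ident[OF e]
        by simp
    qed
    also have "\<dots> < 1 / sqrt 2 * (2 * sqrt 2)"
      using c by (intro mult_strict_right_mono) simp_all
    finally show False by simp
  qed
qed

end
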